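(* Let $S$ and $T$ be compact metric spaces with quasi-visual subdivisions $\{\mathbf X^n\}_{n\in\mathbb N_0}$ and $\{\mathbf Y^n\}_{n\in\mathbb N_0}$, respectively. If $\{\mathbf X^n\}$ and $\{\mathbf Y^n\}$ are isomorphic, with the isomorphism given by a family of bijections $F^n\colon\mathbf X^n\to\mathbf Y^n$, $n\in\mathbb N_0$, then there exists a unique quasisymmetric homeomorphism $F\colon S\to T$ that induces the isomorphism, i.e., such that $F(X)=F^n(X)$ for all $n\in\mathbb N_0$ and $X\in\mathbf X^n$.
   Context: $\mathbb N_0=\{0,1,2,\dots\}$. For non-negative quantities, $a\asymp b$ means $a/C\le b\le Ca$ and $a\gtrsim b$ means $b\le Ca$, with a constant $C>0$. $\operatorname{dist}(X,Y)=\inf\{d(x,y):x\in X,y\in Y\}$. Quasisymmetry: a homeomorphism $F\colon (S,d)\to(T,\rho)$ is quasisymmetric if there exists a homeomorphism $\eta\colon[0,\infty)\to[0,\infty)$ such that for all $t>0$ and all $x,y,z\in S$, $d(x,y)\le t\,d(x,z)$ implies $\rho(F(x),F(y))\le \eta(t)\,\rho(F(x),F(z))$. Quasi-visual approximation: for a bounded metric space $S$, it is a sequence $\{\mathbf X^n\}_{n\in\mathbb N_0}$ of finite covers $\mathbf X^n$ of $S$ by some of its subsets, with $\mathbf X^0=\{S\}$, such that for all $n\in\mathbb N_0$, with implicit constants independent of $n,X,Y$: (i) $\operatorname{diam}(X)\asymp\operatorname{diam}(Y)$ for all $X,Y\in\mathbf X^n$ with $X\cap Y\ne\emptyset$; (ii)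 $\operatorname{dist}(X,Y)\gtrsim\operatorname{diam}(X)$ for all $X,Y\in\mathbf X^n$ with $X\cap Y=\emptyset$; (iii) $\operatorname{diam}(X)\asymp\operatorname{diam}(Y)$ for all $X\in\mathbf X^n$, $Y\in\mathbf X^{n+1}$ with $X\cap Y\ne\emptyset$; (iv) for some constants $k_0\in\mathbb N_0$ and $\lambda\in(0,1)$ independent of $n$, $\operatorname{diam}(Y)\le\lambda\operatorname{diam}(X)$ for all $X\in\mathbf X^n$, $Y\in\mathbf X^{n+k_0}$ with $X\cap Y\ne\emptyset$. Subdivision: a subdivision of a compact metric space $S$ is a sequence $\{\mathbf X^n\}_{n\in\mathbb N_0}$ such that $\mathbf X^0=\{S\}$ and each $\mathbf X^n$ is a finite collection of compact subsets of $S$; for each $n\in\mathbb N_0$ and $Y\in\mathbf X^{n+1}$ there is $X\in\mathbf X^n$ with $Y\subset X$; and for each $n\in\mathbb N_0$ and $X\in\mathbf X^n$, $X=\bigcup\{Y\in\mathbf X^{n+1}:Y\subset X\}$. A quasi-visual subdivision is a subdivision that is also a quasi-visual approximation. Isomorphism: subdivisions $\{\mathbf X^n\}$ of $S$ and $\{\mathbf Y^n\}$ of $T$ are isomorphic if there are bijections $F^n\colon\mathbf X^n\to\mathbf Y^n$, $n\in\mathbb N_0$, such that for all $n\in\mathbb N_0$, $X,Y\in\mathbf X^n$, $X'\in\mathbf X^{n+1}$: $X\cap Y\ne\emptyset$ if and only if $F^n(X)\cap F^n(Y)\neq\emptyset$; and $X'\subset X$ if and only if $F^{n+1}(X')\subset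 F^n(X)$. The isomorphism is then said to be given by $\{F^n\}$. *)

theory Defs
  imports "HOL-Analysis.Analysis" "HOL-Library.FuncSet"
begin

text \<open>Metric spaces are carrier sets in a type of class \<open>metric_space\<close>, with the
  restricted metric.\<close>

definition quasisymmetric_homeomorphism ::
    "'a::metric_space set \<Rightarrow> 'b::metric_space set \<Rightarrow> ('a \<Rightarrow> 'b) \<Rightarrow> bool" where
  "quasisymmetric_homeomorphism S T F \<longleftrightarrow>
     (\<exists>G. homeomorphism S T F G) \<and>
     (\<exists>\<eta> \<theta>. homeomorphism {0::real..} {0::real..} \<eta> \<theta> \<and>
        (\<forall>t>0. \<forall>x\<in>S. \<forall>y\<in>S. \<forall>z\<in>S.
           dist x y \<le> t * dist x z \<longrightarrow> dist (F x) (F y) \<le> \<eta> t * dist (F x) (F z)))"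

definition comparable :: "real \<Rightarrow> real \<Rightarrow> real \<Rightarrow> bool" where
  "comparable C a b \<longleftrightarrow> a / C \<le> b \<and> b \<le> C * a"

text \<open>The empty set is not excluded as a member of a cover. The distance to it is
  \<open>inf \<emptyset> = \<infinity>\<close>, whereas the library sets \<open>setdist X {} = 0\<close>; hence the nonemptiness
  conditions in the separation clause, which is vacuous for empty sets.\<close>

definition quasi_visual_approximation ::
    "'a::metric_space set \<Rightarrow> (nat \<Rightarrow> 'a set set) \<Rightarrow> bool" where
  "quasi_visual_approximation S \<X> \<longleftrightarrow>
     bounded S \<and> \<X> 0 = {S} \<and>
     (\<forall>n. finite (\<X> n) \<and> \<Union>(\<X> n) = S) \<and>
     (\<exists>C>0. \<forall>n. \<forall>X\<in>\<X> n. \<forall>Y\<in>\<X> n. X \<inter> Y \<noteq> {} \<longrightarrow>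
        comparable C (diameter X) (diameter Y)) \<and>
     (\<exists>C>0. \<forall>n. \<forall>X\<in>\<X> n. \<forall>Y\<in>\<X> n. X \<inter> Y = {} \<longrightarrow> X \<noteq> {} \<longrightarrow> Y \<noteq> {} \<longrightarrow>
        diameter X \<le> C * setdist X Y) \<and>
     (\<exists>C>0. \<forall>n. \<forall>X\<in>\<X> n. \<forall>Y\<in>\<X> (Suc n). X \<inter> Y \<noteq> {} \<longrightarrow>
        comparable C (diameter X) (diameter Y)) \<and>
     (\<exists>k\<^sub>0. \<exists>r\<in>{0<..<1}. \<forall>n. \<forall>X\<in>\<X> n. \<forall>Y\<in>\<X> (n + k\<^sub>0). X \<inter> Y \<noteq> {} \<longrightarrow>
        diameter Y \<le> r * diameter X)"

definition subdivision ::
    "'a::metric_space set \<Rightarrow> (nat \<Rightarrow> 'a set set) \<Rightarrow> bool" where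
  "subdivision S \<X> \<longleftrightarrow>
     compact S \<and> \<X> 0 = {S} \<and>
     (\<forall>n. finite (\<X> n) \<and> (\<forall>X\<in>\<X> n. compact X \<and> X \<subseteq> S)) \<and>
     (\<forall>n. \<forall>Y\<in>\<X> (Suc n). \<exists>X\<in>\<X> n. Y \<subseteq> X) \<and>
     (\<forall>n. \<forall>X\<in>\<X> n. X = \<Union>{Y \<in> \<X> (Suc n). Y \<subseteq> X})"

definition quasi_visual_subdivision ::
    "'a::metric_space set \<Rightarrow> (nat \<Rightarrow> 'a set set) \<Rightarrow> bool" where
  "quasi_visual_subdivision S \<X> \<longleftrightarrow> subdivision S \<X> \<and> quasi_visual_approximation S \<X>"

definition subdivision_isomorphism ::
    "(nat \<Rightarrow> 'a set set) \<Rightarrow> (nat \<Rightarrow> 'b set set) \<Rightarrow> (nat \<Rightarrow> 'a set \<Rightarrow> 'b set) \<Rightarrow> bool" where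
  "subdivision_isomorphism \<X> \<Y> \<F> \<longleftrightarrow>
     (\<forall>n. bij_betw (\<F> n) (\<X> n) (\<Y> n)) \<and>
     (\<forall>n. \<forall>X\<in>\<X> n. \<forall>Y\<in>\<X> n. X \<inter> Y \<noteq> {} \<longleftrightarrow> \<F> n X \<inter> \<F> n Y \<noteq> {}) \<and>
     (\<forall>n. \<forall>X\<in>\<X> n. \<forall>X'\<in>\<X> (Suc n). X' \<subseteq> X \<longleftrightarrow> \<F> (Suc n) X' \<subseteq> \<F> n X)"

end

theory Submission
  imports Defs
begin

text \<open>
  The geometry of a quasi-visual approximation is encoded in the combinatorics of its tiles.
  Let \<open>x \<noteq> y\<close> and let \<open>n\<close> be a level at which \<open>x\<close> and \<open>y\<close> lie in intersecting tiles, while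
  at level \<open>n + 1\<close> they do not. Then \<open>dist x y\<close> is comparable to the diameter of any tile of
  level \<open>n\<close> around \<open>x\<close>: two intersecting tiles of comparable size join \<open>x\<close> to \<open>y\<close>, whereas disjoint
  tiles of the next level are separated by a distance proportional to their size
  (\<open>dist_le_if_meet\<close>, \<open>diameter_le_if_not_meet\<close>). Moreover, the diameters of tiles around a fixed
  point shrink along the levels at least and at most geometrically.

  An isomorphism determines a map on points. The images of the tiles around \<open>x\<close> yield a decreasing
  sequence of nonempty compact sets in \<open>T\<close>, so some \<open>y\<close> lies in the image of every tile around
  \<open>x\<close> (\<open>corresponding_point_exists\<close>); it is the only such point, since tile diameters tend to
  \<open>0\<close> (\<open>eq_if_same_tiles\<close>). The inverse isomorphism yields the inverse map, hence the
  map \<open>F\<close> is a bijection and \<open>F x\<close> lies in the image of a tile exactly if \<open>x\<close> lies in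
  the tile (\<open>corresponding_point_iff\<close>). Any map inducing the isomorphism has the defining property of
  \<open>F\<close>, which gives uniqueness.

  Finally, let \<open>dist x y \<le> t * dist x z\<close>, and let \<open>n\<close> and \<open>l\<close> be levels as above for the pairs
  \<open>x, y\<close> and \<open>x, z\<close>. These levels depend only on which tiles intersect, so they are
  also good for the image points. The inequality bounds the ratio of tile
  diameters at \<open>x\<close> of levels \<open>n\<close> and \<open>l\<close>. By geometric shrinking this bounds
  \<open>l - n\<close> above if \<open>n \<le> l\<close>, and \<open>n - l\<close> below if \<open>l \<le> n\<close>, in terms of \<open>ln t\<close>; translated back into
  diameters in \<open>T\<close>, it becomes a bound by a power of \<open>t\<close>
  (\<open>tile_preserving_quasisymmetric_bound\<close>). Continuity of \<open>F\<close> follows from this bound and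
  continuity of \<open>F\<^sup>-\<^sup>1\<close> from compactness.
\<close>

section \<open>Power-type quasisymmetry\<close>

text \<open>Ratios of tile diameters above and below \<open>1\<close> are transported with different exponents, so a
  single power does not suffice as a control function. With a maximum of two powers instead of a
  sum, the inverse is explicit: it is the minimum of the inverse powers.\<close>

lemma homeomorphism_max_powr:
  fixes A B a b :: real
  assumes "A > 0" "B > 0" "a > 0" "b > 0"
  shows "homeomorphism {0..} {0..} (\<lambda>t. B * max ((A * t) powr a) ((A * t) powr b))
           (\<lambda>u. min ((u / B) powr (1 / a)) ((u / B) powr (1 / b)) / A)"
proof -
  have inv1: "min (m powr (1 / a)) (m powr (1 / b)) = v"
    if "v \<ge> 0" and m: "m = max (v powr a) (v powr b)" for v m :: real
  proof (cases "v powr a \<le> v powr b")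
    case True
    have "(v powr b) powr (1 / b) \<le> (v powr b) powr (1 / a)"
      using powr_mono2[of "1 / a" "v powr a" "v powr b"] True assms that by (simp add: powr_powr)
    then show ?thesis using True assms that by (simp add: powr_powr)
  next
    case False
    have "(v powr a) powr (1 / a) \<le> (v powr a) powr (1 / b)"
      using powr_mono2[of "1 / b" "v powr b" "v powr a"] False assms that by (simp add: powr_powr)
    then show ?thesis using False assms that by (simp add: powr_powr)
  qed
  have inv2: "max (m powr a) (m powr b) = u"
    if "u \<ge> 0" and m: "m = min (u powr (1 / a)) (u powr (1 / b))" for u m :: real
  proof (cases "u powr (1 / a) \<le> u powr (1 / b)")
    case True
    have "(u powr (1 / a)) powr b \<le> (u powr (1 / a)) powr a"
      using powr_mono2[of b "u powr (1 / a)" "u powr (1 / b)"] True assms that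
      by (simp add: powr_powr)
    then show ?thesis using True assms that by (simp add: powr_powr)
  next
    case False
    have "(u powr (1 / b)) powr a \<le> (u powr (1 / b)) powr b"
      using powr_mono2[of a "u powr (1 / b)" "u powr (1 / a)"] False assms that
      by (simp add: powr_powr)
    then show ?thesis using False assms that by (simp add: powr_powr)
  qed
  show ?thesis
  proof (rule homeomorphismI)
    show "continuous_on {0..} (\<lambda>t. B * max ((A * t) powr a) ((A * t) powr b))"
      using assms by (intro continuous_intros continuous_on_powr') auto
    show "continuous_on {0..} (\<lambda>u. min ((u / B) powr (1 / a)) ((u / B) powr (1 / b)) / A)"
      using assms by (intro continuous_intros continuous_on_powr') auto
    show "(\<lambda>t. B * max ((A * t) powr a) ((A * t) powr b)) ` {0..} \<subseteq> {0..}"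
      using assms by (auto simp: le_max_iff_disj)
    show "(\<lambda>u. min ((u / B) powr (1 / a)) ((u / B) powr (1 / b)) / A) ` {0..} \<subseteq> {0..}"
      using assms by auto
  next
    fix t :: real assume "t \<in> {0..}"
    with inv1[of "A * t", OF _ refl] assms
    show "min ((B * max ((A * t) powr a) ((A * t) powr b) / B) powr (1 / a))
              ((B * max ((A * t) powr a) ((A * t) powr b) / B) powr (1 / b)) / A = t"
      by simp
  next
    fix u :: real assume "u \<in> {0..}"
    with inv2[of "u / B", OF _ refl] assms
    show "B * max ((A * (min ((u / B) powr (1 / a)) ((u / B) powr (1 / b)) / A)) powr a)
                  ((A * (min ((u / B) powr (1 / a)) ((u / B) powr (1 / b)) / A)) powr b) = u"
      by simp
  qed
qed

text \<open>Converts geometric growth in the number of levels from the rate of one space to the rate of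
  the other, at the price of an exponent that is independent of the number of levels.\<close>

lemma power_eq_powr_power:
  fixes p q :: real
  assumes "p > 1" "q > 1"
  obtains a where "a > 0" "\<And>k. q ^ k = (p ^ k) powr a"
proof
  show "log p q > 0" using assms by simp
  show "q ^ k = (p ^ k) powr (log p q)" for k
  proof -
    have "(p ^ k) powr (log p q) = (p powr (log p q)) powr real k"
      using assms by (simp only: powr_powr mult.commute flip: powr_realpow)
    then show ?thesis using assms by (simp add: powr_realpow)
  qed
qed

text \<open>For a fixed \<open>z \<noteq> x\<close>, apply the bound with \<open>t = dist x y / dist x z\<close>, which
  tends to \<open>0\<close> as \<open>y\<close> tends to \<open>x\<close>.\<close>

lemma quasisymmetric_bound_imp_continuous:
  fixes F :: "'a::metric_space \<Rightarrow> 'b::metric_space" and \<eta> :: "real \<Rightarrow> real"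
  assumes cont: "continuous_on {0..} \<eta>" and zero: "\<eta> 0 = 0"
    and qs: "\<And>t x y z. \<lbrakk>t > 0; x \<in> S; y \<in> S; z \<in> S; dist x y \<le> t * dist x z\<rbrakk>
               \<Longrightarrow> dist (F x) (F y) \<le> \<eta> t * dist (F x) (F z)"
  shows "continuous_on S F"
proof (cases "\<exists>x. S \<subseteq> {x}")
  case True
  then show ?thesis by (metis continuous_on_sing continuous_on_subset)
next
  case False
  show ?thesis
    unfolding continuous_on_def
  proof
    fix x assume x: "x \<in> S"
    with False obtain z where z: "z \<in> S" "z \<noteq> x" by blast
    let ?t = "\<lambda>y. dist x y / dist x z"
    have "continuous_on S (\<lambda>y. \<eta> (?t y) * dist (F x) (F z))"
      using z by (intro continuous_intros continuous_on_compose2[OF cont]) auto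
    then have lim: "((\<lambda>y. \<eta> (?t y) * dist (F x) (F z)) \<longlongrightarrow> 0) (at x within S)"
      using x zero by (auto simp: continuous_on_def)
    have "\<forall>\<^sub>F y in at x within S. dist (F y) (F x) \<le> \<eta> (?t y) * dist (F x) (F z)"
      unfolding eventually_at_filter
    proof (intro always_eventually allI impI)
      fix y assume "y \<noteq> x" "y \<in> S"
      then show "dist (F y) (F x) \<le> \<eta> (?t y) * dist (F x) (F z)"
        using qs[of "?t y" x y z] x z by (simp add: dist_commute)
    qed
    then have "((\<lambda>y. dist (F y) (F x)) \<longlongrightarrow> 0) (at x within S)"
      by (intro tendsto_sandwich[OF _ _ tendsto_const lim]) auto
    then show "(F \<longlongrightarrow> F x) (at x within S)"
      by (rule tendsto_dist_iff[THEN iffD2])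
  qed
qed

section \<open>Uniform scales of quasi-visual approximations\<close>

text \<open>The conditions on tiles of neighbouring levels, integrated over arbitrarily many levels and
  with all multiplicative constants merged into \<open>C\<close>: around a common point, up to the
  factor \<open>C\<close>, \<open>k\<close> levels multiply the diameters by at least \<open>(1 / C) ^ k\<close> and at most \<open>s ^ k\<close>.\<close>

locale scaled_tiles =
  fixes S :: "'a::metric_space set" and \<X> :: "nat \<Rightarrow> 'a set set" and C s :: real
  assumes bounded: "bounded S" and root: "\<X> 0 = {S}"
    and finite_tiles: "\<And>n. finite (\<X> n)"
    and cover: "\<And>n. \<Union>(\<X> n) = S"
    and C_gt_1: "C > 1" and s_pos: "s > 0" and s_lt_1: "s < 1"
    and diameter_le_descendant: "\<And>n k X Y x. \<lbrakk>X \<in> \<X> n; Y \<in> \<X> (n + k); x \<in> X; x \<in> Y\<rbrakk>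
          \<Longrightarrow> diameter X \<le> C * C ^ k * diameter Y"
    and descendant_diameter_le: "\<And>n k X Y x. \<lbrakk>X \<in> \<X> n; Y \<in> \<X> (n + k); x \<in> X; x \<in> Y\<rbrakk>
          \<Longrightarrow> diameter Y \<le> C * s ^ k * diameter X"
    and separation: "\<And>n X Y x y. \<lbrakk>X \<in> \<X> n; Y \<in> \<X> n; X \<inter> Y = {}; x \<in> X; y \<in> Y\<rbrakk>
          \<Longrightarrow> diameter X \<le> C * dist x y"
begin

lemma tile_subset: "X \<in> \<X> n \<Longrightarrow> X \<subseteq> S"
  by (metis cover Union_upper)

lemma tile_bounded: "X \<in> \<X> n \<Longrightarrow> bounded X"
  by (rule bounded_subset[OF bounded tile_subset])

lemma diameter_nonneg: "X \<in> \<X> n \<Longrightarrow> diameter X \<ge> 0"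
  by (rule diameter_ge_0[OF tile_bounded])

lemma dist_le_diameter: "X \<in> \<X> n \<Longrightarrow> x \<in> X \<Longrightarrow> y \<in> X \<Longrightarrow> dist x y \<le> diameter X"
  by (rule diameter_bounded_bound[OF tile_bounded])

lemma obtain_tile: assumes "x \<in> S" obtains X where "X \<in> \<X> n" "x \<in> X"
  using assms by (metis cover UnionE)

lemma diameter_small:
  assumes "\<epsilon> > 0"
  obtains N where "\<And>n X x. \<lbrakk>n \<ge> N; X \<in> \<X> n; x \<in> X\<rbrakk> \<Longrightarrow> diameter X < \<epsilon>"
proof -
  have "(\<lambda>n. C * s ^ n * diameter S) \<longlonglongrightarrow> C * 0 * diameter S"
    by (intro tendsto_mult tendsto_const LIMSEQ_realpow_zero) (use s_pos s_lt_1 in auto)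
  then have "\<forall>\<^sub>F n in sequentially. C * s ^ n * diameter S < \<epsilon>"
    by (rule order_tendstoD(2)) (use assms in simp)
  then obtain N where N: "\<And>n. n \<ge> N \<Longrightarrow> C * s ^ n * diameter S < \<epsilon>"
    by (auto simp: eventually_sequentially)
  show thesis
  proof
    fix n X x assume *: "n \<ge> N" "X \<in> \<X> n" "x \<in> X"
    have "diameter X \<le> C * s ^ n * diameter S"
      using * descendant_diameter_le[of S 0 X n x] root tile_subset by auto
    also have "\<dots> < \<epsilon>" using N *(1) .
    finally show "diameter X < \<epsilon>" .
  qed
qed

lemma eq_if_same_tiles:
  assumes tile: "\<And>n. \<exists>X\<in>\<X> n. x \<in> X \<and> y \<in> X"
  shows "x = y"
proof (rule ccontr)
  assume "x \<noteq> y"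
  then obtain N where N: "\<And>n X z. \<lbrakk>n \<ge> N; X \<in> \<X> n; z \<in> X\<rbrakk> \<Longrightarrow> diameter X < dist x y"
    using diameter_small[of "dist x y"] by auto
  obtain X where X: "X \<in> \<X> N" "x \<in> X" "y \<in> X" using tile by blast
  show False using N[OF order_refl X(1,2)] dist_le_diameter[OF X] by simp
qed

text \<open>The relation replacing the distance: it is expressed by incidences of points and tiles
  and by intersections of tiles, and is therefore transported by isomorphisms.\<close>

definition meet_at :: "nat \<Rightarrow> 'a \<Rightarrow> 'a \<Rightarrow> bool" where
  "meet_at n x y \<longleftrightarrow> (\<exists>X\<in>\<X> n. \<exists>Y\<in>\<X> n. x \<in> X \<and> y \<in> Y \<and> X \<inter> Y \<noteq> {})"

lemma dist_le_if_meet: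
  assumes "meet_at n x y" and Z: "Z \<in> \<X> n" "x \<in> Z"
  shows "dist x y \<le> 2 * C\<^sup>2 * diameter Z"
proof -
  obtain X Y w where XY: "X \<in> \<X> n" "Y \<in> \<X> n" "x \<in> X" "y \<in> Y" "w \<in> X" "w \<in> Y"
    using assms(1) unfolding meet_at_def by blast
  have XZ: "diameter X \<le> C * diameter Z"
    using diameter_le_descendant[of X n Z 0 x] XY Z by simp
  have "diameter Y \<le> C * diameter X"
    using diameter_le_descendant[of Y n X 0 w] XY by simp
  also have "\<dots> \<le> C * (C * diameter Z)" using XZ C_gt_1 by simp
  finally have Y: "diameter Y \<le> C * (C * diameter Z)" .
  have "C * diameter Z \<le> C * (C * diameter Z)"
    using mult_right_mono[of 1 C "diameter Z"] C_gt_1 diameter_nonneg[OF Z(1)] by simp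
  then have "diameter X + diameter Y \<le> 2 * (C * (C * diameter Z))" using XZ Y by linarith
  moreover have "dist x y \<le> dist x w + dist w y" by (rule dist_triangle)
  moreover have "dist x w \<le> diameter X" "dist w y \<le> diameter Y"
    using XY dist_le_diameter by auto
  ultimately show ?thesis by (simp add: power2_eq_square mult_ac)
qed

lemma diameter_le_if_not_meet:
  assumes "\<not> meet_at (Suc n) x y" and Z: "Z \<in> \<X> n" "x \<in> Z" and y: "y \<in> S"
  shows "diameter Z \<le> C ^ 3 * dist x y"
proof -
  have x: "x \<in> S" using Z tile_subset by blast
  obtain X where X: "X \<in> \<X> (Suc n)" "x \<in> X" using obtain_tile[OF x] .
  obtain Y where Y: "Y \<in> \<X> (Suc n)" "y \<in> Y" using obtain_tile[OF y] .
  have "X \<inter> Y = {}" using assms(1) X Y unfolding meet_at_def by blast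
  then have "diameter X \<le> C * dist x y" using separation[of X "Suc n" Y] X Y by blast
  moreover have "diameter Z \<le> C\<^sup>2 * diameter X"
    using diameter_le_descendant[of Z n X 1 x] X Z by (simp add: power2_eq_square)
  moreover have "C\<^sup>2 * diameter X \<le> C\<^sup>2 * (C * dist x y)"
    using calculation(1) by (intro mult_left_mono) auto
  ultimately show ?thesis by (simp add: power2_eq_square power3_eq_cube mult_ac)
qed

text \<open>Intersecting tiles of level \<open>0\<close> always exist, as \<open>S\<close> is a tile, and intersecting
  tiles of high levels are too small to join two distinct points. Any level at which \<open>meet_at\<close>
  switches from true to false serves to measure the distance.\<close>

lemma separation_level:
  assumes "x \<in> S" "y \<in> S" "x \<noteq> y"
  obtains n where "meet_at n x y" "\<not> meet_at (Suc n) x y"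
proof -
  have "\<not> (\<forall>n. meet_at n x y)"
  proof
    assume meet: "\<forall>n. meet_at n x y"
    have "dist x y / (2 * C\<^sup>2) > 0" using assms(3) C_gt_1 by simp
    then obtain N where N: "\<And>n X z. \<lbrakk>n \<ge> N; X \<in> \<X> n; z \<in> X\<rbrakk> \<Longrightarrow> diameter X < dist x y / (2 * C\<^sup>2)"
      using diameter_small by blast
    obtain Z where Z: "Z \<in> \<X> N" "x \<in> Z" using obtain_tile[OF assms(1)] .
    have "2 * C\<^sup>2 * diameter Z < dist x y"
      using N[OF order_refl Z] C_gt_1 by (simp add: field_simps)
    then show False using dist_le_if_meet[of N x y Z] meet Z by simp
  qed
  moreover have "meet_at 0 x y" using root assms by (auto simp: meet_at_def)
  ultimately show thesis using that nat_induct[of "\<lambda>n. meet_at n x y"] by blast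
qed

end

text \<open>Chains of tiles around a common point pass from single steps to many levels. The contraction by
  \<open>r\<close> is available only in steps of \<open>m\<close> levels; spreading it evenly gives the rate
  \<open>s = root m r\<close>, and the incomplete last step costs a bounded factor.\<close>

lemma quasi_visual_approximation_scaled:
  assumes qv: "quasi_visual_approximation S \<X>"
  obtains C s where "scaled_tiles S \<X> C s"
proof -
  have bdd: "bounded S" and root: "\<X> 0 = {S}" and fin: "\<And>n. finite (\<X> n)"
    and cov: "\<And>n. \<Union>(\<X> n) = S"
    using qv unfolding quasi_visual_approximation_def by auto
  note conditions = qv[unfolded quasi_visual_approximation_def,
      THEN conjunct2, THEN conjunct2, THEN conjunct2]
  obtain c1 where c1: "c1 > 0"
    and 1: "\<And>n X Y. \<lbrakk>X \<in> \<X> n; Y \<in> \<X> n; X \<inter> Y \<noteq> {}\<rbrakk> \<Longrightarrow> comparable c1 (diameter X) (diameter Y)"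
    using conditions[THEN conjunct1]
    by (elim exE bexE conjE) (rule that, assumption, simp)
  obtain c2 where c2: "c2 > 0"
    and 2: "\<And>n X Y. \<lbrakk>X \<in> \<X> n; Y \<in> \<X> n; X \<inter> Y = {}; X \<noteq> {}; Y \<noteq> {}\<rbrakk>
              \<Longrightarrow> diameter X \<le> c2 * setdist X Y"
    using conditions[THEN conjunct2, THEN conjunct1]
    by (elim exE bexE conjE) (rule that, assumption, simp)
  obtain c3 where c3: "c3 > 0"
    and 3: "\<And>n X Y. \<lbrakk>X \<in> \<X> n; Y \<in> \<X> (Suc n); X \<inter> Y \<noteq> {}\<rbrakk>
              \<Longrightarrow> comparable c3 (diameter X) (diameter Y)"
    using conditions[THEN conjunct2, THEN conjunct2, THEN conjunct1]
    by (elim exE bexE conjE) (rule that, assumption, simp)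
  obtain k0 r where r': "r \<in> {0<..<1}"
    and 4: "\<forall>n. \<forall>X\<in>\<X> n. \<forall>Y\<in>\<X> (n + k0). X \<inter> Y \<noteq> {} \<longrightarrow> diameter Y \<le> r * diameter X"
    using conditions[THEN conjunct2, THEN conjunct2, THEN conjunct2]
    by (elim exE bexE) (rule that)
  have r: "0 < r" "r < 1" using r' by auto
  note c = c1 c2 c3
  have pos: "diameter X \<ge> 0" if "X \<in> \<X> n" for X n
    using that cov bdd by (metis Sup_upper bounded_subset diameter_ge_0)
  define c where "c = Max {2, c1, c2, c3}"
  have c_ge: "c \<ge> 2" "c1 \<le> c" "c2 \<le> c" "c3 \<le> c" by (auto simp: c_def)
  have same: "diameter X \<le> c * diameter Y" if "X \<in> \<X> n" "Y \<in> \<X> n" "x \<in> X" "x \<in> Y" for n X Y x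
  proof -
    have "diameter X \<le> c1 * diameter Y"
      using 1[of Y n X] that by (auto simp: comparable_def)
    also have "\<dots> \<le> c * diameter Y" using c_ge pos[OF that(2)] by (intro mult_right_mono) auto
    finally show ?thesis .
  qed
  have next_le: "diameter Y \<le> c * diameter X" and le_next: "diameter X \<le> c * diameter Y"
    if "X \<in> \<X> n" "Y \<in> \<X> (Suc n)" "x \<in> X" "x \<in> Y" for n X Y x
  proof -
    have *: "diameter X / c3 \<le> diameter Y" "diameter Y \<le> c3 * diameter X"
      using 3[of X n Y] that by (auto simp: comparable_def)
    then have "diameter X \<le> c3 * diameter Y" using c by (simp add: field_simps)
    also have "\<dots> \<le> c * diameter Y" using c_ge pos[OF that(2)] by (intro mult_right_mono) auto
    finally show "diameter X \<le> c * diameter Y" .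
    have "c3 * diameter X \<le> c * diameter X"
      using c_ge pos[OF that(1)] by (intro mult_right_mono) auto
    then show "diameter Y \<le> c * diameter X" using * by linarith
  qed
  have up: "diameter X \<le> c * c ^ k * diameter Y \<and> diameter Y \<le> c * c ^ k * diameter X"
    if "X \<in> \<X> n" "Y \<in> \<X> (n + k)" "x \<in> X" "x \<in> Y" for n k X Y x
    using that
  proof (induction k arbitrary: Y)
    case 0
    then show ?case using same by auto
  next
    case (Suc k)
    obtain Z where Z: "Z \<in> \<X> (n + k)" "x \<in> Z"
      using Suc.prems cov by (metis UnionE UnionI)
    note IH = Suc.IH[OF Suc.prems(1) Z(1) Suc.prems(3) Z(2)]
    have "c * c ^ k * diameter Z \<le> c * c ^ k * (c * diameter Y)"
      using le_next[of Z "n + k" Y x] Z Suc.prems c_ge by (intro mult_left_mono) auto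
    moreover have "diameter Y \<le> c * diameter Z"
      using next_le[of Z "n + k" Y x] Z Suc.prems by auto
    moreover have "c * diameter Z \<le> c * (c * c ^ k * diameter X)"
      using IH c_ge by (intro mult_left_mono) auto
    ultimately show ?case using IH by (simp add: mult_ac)
  qed
  \<comment> \<open>With \<open>k0 = 0\<close> the contraction forces all diameters to vanish, so any step works.\<close>
  define m where "m = max 1 k0"
  have step: "diameter Y \<le> r * diameter X"
    if "X \<in> \<X> n" "Y \<in> \<X> (n + m)" "x \<in> X" "x \<in> Y" for n X Y x
  proof (cases "k0 = 0")
    case True
    have "diameter Y \<le> r * diameter Y" using 4 True that by auto
    then have "diameter Y \<le> 0" using r by (simp add: mult_le_cancel_right1)
    then show ?thesis using r pos[OF that(1)] by (smt (verit) mult_nonneg_nonneg)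
  next
    case False
    then have "m = k0" by (simp add: m_def)
    then show ?thesis using 4 that by blast
  qed
  have steps: "diameter Y \<le> c * r ^ q * diameter X"
    if "X \<in> \<X> n" "Y \<in> \<X> (n + q * m)" "x \<in> X" "x \<in> Y" for n q X Y x
    using that
  proof (induction q arbitrary: Y)
    case 0
    then show ?case using same by auto
  next
    case (Suc q)
    obtain Z where Z: "Z \<in> \<X> (n + q * m)" "x \<in> Z"
      using Suc.prems cov by (metis UnionE UnionI)
    have "diameter Y \<le> r * diameter Z"
      using step[of Z "n + q * m" Y x] Z Suc.prems by (simp add: add_ac)
    also have "\<dots> \<le> r * (c * r ^ q * diameter X)"
      using Suc.IH[OF Suc.prems(1) Z(1) Suc.prems(3) Z(2)] r by (intro mult_left_mono) auto
    finally show ?case by (simp add: mult_ac)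
  qed
  have m: "m \<ge> 1" by (simp add: m_def)
  define s where "s = root m r"
  have s: "0 < s" "s < 1" "s ^ m = r" using r m by (auto simp: s_def)
  define C where "C = c * c ^ m * c / r"
  have C: "c \<le> C"
  proof -
    have "1 * 1 \<le> c ^ m * c" using c_ge by (intro mult_mono one_le_power) auto
    then have "c * r \<le> c * (c ^ m * c)" using r c_ge by (intro mult_left_mono) auto
    then show ?thesis using r by (simp add: C_def field_simps)
  qed
  have "scaled_tiles S \<X> C s"
  proof
    fix n k X Y x assume *: "X \<in> \<X> n" "Y \<in> \<X> (n + k)" "x \<in> X" "x \<in> Y"
    have "c * c ^ k * diameter Y \<le> C * C ^ k * diameter Y"
      using C c_ge pos[OF *(2)] by (intro mult_right_mono mult_mono power_mono) auto
    then show "diameter X \<le> C * C ^ k * diameter Y" using up[OF *] by linarith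
    define q j where "q = k div m" and "j = k mod m"
    have k: "k = q * m + j" and j: "j \<le> m" using m by (auto simp: q_def j_def less_imp_le)
    obtain Z where Z: "Z \<in> \<X> (n + q * m)" "x \<in> Z"
      using * cov by (metis UnionE UnionI)
    have "r ^ q * r \<le> r ^ q * s ^ j"
      using power_decreasing[OF j, of s] s r by (intro mult_left_mono) auto
    also have "\<dots> = s ^ k" using s(3) by (simp add: k power_add power_mult mult.commute)
    finally have rs: "r ^ q \<le> s ^ k / r" using r by (simp add: field_simps)
    have "diameter Y \<le> c * c ^ j * diameter Z"
      using up[of Z "n + q * m" Y j x] Z * k by (simp add: add_ac)
    also have "\<dots> \<le> c * c ^ m * (c * r ^ q * diameter X)"
      using steps[OF *(1) Z(1) *(3) Z(2)] c_ge j pos[OF Z(1)]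
      by (intro mult_mono mult_left_mono power_increasing) auto
    also have "\<dots> \<le> c * c ^ m * (c * (s ^ k / r) * diameter X)"
      using rs c_ge pos[OF *(1)] by (intro mult_left_mono mult_right_mono) auto
    also have "\<dots> = C * s ^ k * diameter X" by (simp add: C_def)
    finally show "diameter Y \<le> C * s ^ k * diameter X" .
  next
    fix n X Y x y assume *: "X \<in> \<X> n" "Y \<in> \<X> n" "X \<inter> Y = {}" "x \<in> X" "y \<in> Y"
    then have "diameter X \<le> c2 * setdist X Y" using 2[of X n Y] by blast
    also have "\<dots> \<le> C * dist x y"
      using C c_ge c setdist_le_dist[OF *(4,5)] by (intro mult_mono) auto
    finally show "diameter X \<le> C * dist x y" .
  qed (use bdd root fin cov C c_ge s in auto)
  then show thesis by (rule that)
qed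

section \<open>The induced map on points\<close>

lemma
  assumes "subdivision_isomorphism \<X> \<Y> \<F>"
  shows iso_bij: "bij_betw (\<F> n) (\<X> n) (\<Y> n)"
    and iso_image: "X \<in> \<X> n \<Longrightarrow> \<F> n X \<in> \<Y> n"
    and iso_meet_iff: "\<lbrakk>X \<in> \<X> n; Y \<in> \<X> n\<rbrakk> \<Longrightarrow> \<F> n X \<inter> \<F> n Y \<noteq> {} \<longleftrightarrow> X \<inter> Y \<noteq> {}"
    and iso_subset_iff: "\<lbrakk>X \<in> \<X> n; Z \<in> \<X> (Suc n)\<rbrakk> \<Longrightarrow> \<F> (Suc n) Z \<subseteq> \<F> n X \<longleftrightarrow> Z \<subseteq> X"
  using assms bij_betwE[of "\<F> n" "\<X> n" "\<Y> n"]
  unfolding subdivision_isomorphism_def by auto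

lemma
  assumes "subdivision S \<X>"
  shows subdivision_compact: "X \<in> \<X> n \<Longrightarrow> compact X"
    and subdivision_parent: "Z \<in> \<X> (Suc n) \<Longrightarrow> \<exists>X\<in>\<X> n. Z \<subseteq> X"
    and subdivision_child: "X \<in> \<X> n \<Longrightarrow> x \<in> X \<Longrightarrow> \<exists>Z\<in>\<X> (Suc n). Z \<subseteq> X \<and> x \<in> Z"
proof -
  show "X \<in> \<X> n \<Longrightarrow> compact X" and "Z \<in> \<X> (Suc n) \<Longrightarrow> \<exists>X\<in>\<X> n. Z \<subseteq> X"
    using assms by (simp_all add: subdivision_def)
  assume X: "X \<in> \<X> n" "x \<in> X"
  then have "X = \<Union>{Z \<in> \<X> (Suc n). Z \<subseteq> X}"
    using assms by (simp add: subdivision_def)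
  with X(2) have "x \<in> \<Union>{Z \<in> \<X> (Suc n). Z \<subseteq> X}" by (rule subst[rotated])
  then show "\<exists>Z\<in>\<X> (Suc n). Z \<subseteq> X \<and> x \<in> Z" by blast
qed

lemma subdivision_isomorphism_inverse:
  assumes "subdivision_isomorphism \<X> \<Y> \<F>"
  shows "subdivision_isomorphism \<Y> \<X> (\<lambda>n. inv_into (\<X> n) (\<F> n))"
proof -
  let ?G = "\<lambda>n. inv_into (\<X> n) (\<F> n)"
  note bij = iso_bij[OF assms]
  have mem: "?G n Y \<in> \<X> n" and eq: "\<F> n (?G n Y) = Y" if "Y \<in> \<Y> n" for n Y
    using bij[of n] that by (auto simp: bij_betw_def inv_into_into f_inv_into_f)
  show ?thesis
    unfolding subdivision_isomorphism_def
  proof (intro conjI allI ballI)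
    show "bij_betw (?G n) (\<Y> n) (\<X> n)" for n
      using bij by (rule bij_betw_inv_into)
    show "X \<inter> Y \<noteq> {} \<longleftrightarrow> ?G n X \<inter> ?G n Y \<noteq> {}" if "X \<in> \<Y> n" "Y \<in> \<Y> n" for n X Y
      using iso_meet_iff[OF assms mem mem] eq that by metis
    show "Z \<subseteq> X \<longleftrightarrow> ?G (Suc n) Z \<subseteq> ?G n X" if "X \<in> \<Y> n" "Z \<in> \<Y> (Suc n)" for n X Z
      using iso_subset_iff[OF assms mem mem] eq that by metis
  qed
qed

lemma descendant_tile:
  assumes "subdivision S \<X>" "subdivision_isomorphism \<X> \<Y> \<F>" "X \<in> \<X> n" "x \<in> X"
  shows "\<exists>X'\<in>\<X> (n + k). x \<in> X' \<and> \<F> (n + k) X' \<subseteq> \<F> n X"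
proof (induction k)
  case 0
  then show ?case using assms by auto
next
  case (Suc k)
  then obtain X' where X': "X' \<in> \<X> (n + k)" "x \<in> X'" "\<F> (n + k) X' \<subseteq> \<F> n X" by blast
  then obtain X'' where X'': "X'' \<in> \<X> (Suc (n + k))" "X'' \<subseteq> X'" "x \<in> X''"
    using subdivision_child[OF assms(1)] by metis
  then have "\<F> (Suc (n + k)) X'' \<subseteq> \<F> (n + k) X'"
    using iso_subset_iff[OF assms(2)] X' by metis
  then show ?case using X' X'' by auto
qed

text \<open>Tiles around \<open>x\<close> need not be nested, but the union \<open>N n\<close> of the images of all
  level-\<open>n\<close> tiles around \<open>x\<close> decreases in \<open>n\<close>, since every tile has a parent. A point \<open>y\<close> in
  all \<open>N n\<close> lies in the image of each tile \<open>X\<close> around \<open>x\<close>: the image of \<open>X\<close> is closed, and it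
  meets arbitrarily small image tiles around \<open>y\<close>, because \<open>X\<close> has descendants around \<open>x\<close>
  at every level.\<close>

lemma corresponding_point_exists:
  fixes \<X> :: "nat \<Rightarrow> 'a::metric_space set set" and \<Y> :: "nat \<Rightarrow> 'b::metric_space set set"
  assumes sub: "subdivision S \<X>" and sub': "subdivision T \<Y>"
    and tiles: "scaled_tiles S \<X> C s" and tiles': "scaled_tiles T \<Y> D r"
    and iso: "subdivision_isomorphism \<X> \<Y> \<F>" and x: "x \<in> S"
  shows "\<exists>y\<in>T. \<forall>n. \<forall>X\<in>\<X> n. x \<in> X \<longrightarrow> y \<in> \<F> n X"
proof -
  interpret X: scaled_tiles S \<X> C s by (fact tiles)
  interpret Y: scaled_tiles T \<Y> D r by (fact tiles')
  have image: "\<F> n X \<in> \<Y> n" if "X \<in> \<X> n" for n X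
    using iso_image[OF iso that] .
  have meet: "\<F> n X \<inter> \<F> n Y \<noteq> {}" if "X \<in> \<X> n" "Y \<in> \<X> n" "z \<in> X" "z \<in> Y" for n X Y z
    using iso_meet_iff[OF iso that(1,2)] that(3,4) by blast
  have compact: "compact (\<F> n X)" if "X \<in> \<X> n" for n X
    using subdivision_compact[OF sub' image[OF that]] .
  define N where "N n = \<Union>(\<F> n ` {X \<in> \<X> n. x \<in> X})" for n
  have N_compact: "compact (N n)" for n
    unfolding N_def using X.finite_tiles[of n] compact by (intro compact_Union) auto
  have N_nonempty: "N n \<noteq> {}" for n
  proof -
    obtain X where X: "X \<in> \<X> n" "x \<in> X" using X.obtain_tile[OF x] .
    then show "N n \<noteq> {}" using meet[of X n X x] unfolding N_def by blast
  qed
  have "N (Suc n) \<subseteq> N n" for n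
  proof
    fix y assume "y \<in> N (Suc n)"
    then obtain X where X: "X \<in> \<X> (Suc n)" "x \<in> X" "y \<in> \<F> (Suc n) X"
      unfolding N_def by blast
    then obtain X' where X': "X' \<in> \<X> n" "X \<subseteq> X'"
      using subdivision_parent[OF sub] by metis
    then have "\<F> (Suc n) X \<subseteq> \<F> n X'"
      using iso_subset_iff[OF iso] X by metis
    then show "y \<in> N n" using X X' unfolding N_def by blast
  qed
  then have N_antimono: "N n \<subseteq> N m" if "m \<le> n" for m n
    using lift_Suc_antimono_le[of N] that by blast
  have "N 0 \<inter> (\<Inter>n\<in>UNIV. N n) \<noteq> {}"
  proof (rule compact_imp_fip_image[OF N_compact compact_imp_closed[OF N_compact]])
    fix I :: "nat set" assume "finite I"
    then have "N (Max (insert 0 I)) \<subseteq> N i" if "i \<in> insert 0 I" for i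
      using N_antimono that by simp
    then show "N 0 \<inter> (\<Inter>i\<in>I. N i) \<noteq> {}"
      using N_nonempty[of "Max (insert 0 I)"] by blast
  qed
  then obtain y where y: "\<And>n. y \<in> N n" by blast
  have "y \<in> \<F> n X" if X: "X \<in> \<X> n" "x \<in> X" for n X
  proof -
    have "closed (\<F> n X)" using compact X compact_imp_closed by blast
    moreover have "\<exists>w\<in>\<F> n X. dist w y < \<epsilon>" if "\<epsilon> > 0" for \<epsilon>
    proof -
      obtain M where M: "\<And>m Y z. \<lbrakk>m \<ge> M; Y \<in> \<Y> m; z \<in> Y\<rbrakk> \<Longrightarrow> diameter Y < \<epsilon>"
        using Y.diameter_small[OF \<open>\<epsilon> > 0\<close>] by blast
      obtain X' where X': "X' \<in> \<X> (n + M)" "x \<in> X'" "\<F> (n + M) X' \<subseteq> \<F> n X"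
        using descendant_tile[OF sub iso X] by blast
      obtain Z where Z: "Z \<in> \<X> (n + M)" "x \<in> Z" "y \<in> \<F> (n + M) Z"
        using y[of "n + M"] unfolding N_def by blast
      obtain w where w: "w \<in> \<F> (n + M) X'" "w \<in> \<F> (n + M) Z"
        using meet[of X' "n + M" Z x] X' Z by blast
      have "dist w y \<le> diameter (\<F> (n + M) Z)"
        using Y.dist_le_diameter[OF image[OF Z(1)] w(2) Z(3)] .
      also have "\<dots> < \<epsilon>" using M[OF _ image[OF Z(1)] Z(3)] by simp
      finally show ?thesis using w X' by blast
    qed
    ultimately show ?thesis by (metis closed_approachable)
  qed
  moreover have "y \<in> T" using y[of 0] image[of _ 0] Y.root unfolding N_def by blast
  ultimately show ?thesis by blast
qed

text \<open>The inverse isomorphism assigns to \<open>y\<close> a point \<open>x'\<close> that shares with \<open>x\<close> all tiles around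
  \<open>x\<close>, so \<open>x' = x\<close>; hence every tile whose image contains \<open>y\<close> contains \<open>x\<close>.\<close>

lemma corresponding_point_iff:
  fixes \<X> :: "nat \<Rightarrow> 'a::metric_space set set" and \<Y> :: "nat \<Rightarrow> 'b::metric_space set set"
  assumes sub: "subdivision S \<X>" and sub': "subdivision T \<Y>"
    and tiles: "scaled_tiles S \<X> C s" and tiles': "scaled_tiles T \<Y> D r"
    and iso: "subdivision_isomorphism \<X> \<Y> \<F>" and x: "x \<in> S"
    and y: "y \<in> T" "\<And>n X. \<lbrakk>X \<in> \<X> n; x \<in> X\<rbrakk> \<Longrightarrow> y \<in> \<F> n X"
    and X: "X \<in> \<X> n"
  shows "x \<in> X \<longleftrightarrow> y \<in> \<F> n X"
proof
  interpret X: scaled_tiles S \<X> C s by (fact tiles)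
  define \<G> where "\<G> n = inv_into (\<X> n) (\<F> n)" for n
  note bij = iso_bij[OF iso]
  have image: "\<F> n Z \<in> \<Y> n" and inv: "\<G> n (\<F> n Z) = Z" if "Z \<in> \<X> n" for n Z
    using bij[of n] that by (auto simp: \<G>_def bij_betw_def)
  have iso': "subdivision_isomorphism \<Y> \<X> \<G>"
    using subdivision_isomorphism_inverse[OF iso] unfolding \<G>_def .
  obtain x' where x': "x' \<in> S" "\<And>n Y. \<lbrakk>Y \<in> \<Y> n; y \<in> Y\<rbrakk> \<Longrightarrow> x' \<in> \<G> n Y"
    using corresponding_point_exists[OF sub' sub tiles' tiles iso' y(1)] by blast
  have pullback: "x' \<in> Z" if "Z \<in> \<X> m" "y \<in> \<F> m Z" for m Z
    using x'(2)[OF image] inv that by metis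
  have "x = x'"
  proof (rule X.eq_if_same_tiles)
    fix m
    obtain Z where "Z \<in> \<X> m" "x \<in> Z" using X.obtain_tile[OF x] .
    then show "\<exists>Z\<in>\<X> m. x \<in> Z \<and> x' \<in> Z" using pullback y(2) by blast
  qed
  then show "y \<in> \<F> n X \<Longrightarrow> x \<in> X" using pullback X by blast
qed (use y X in blast)

section \<open>Tile-preserving maps are quasisymmetric\<close>

text \<open>If \<open>l = n + k\<close>, then contraction in \<open>S\<close> gives \<open>(1 / s) ^ k \<le> A * t\<close>, and \<open>D ^ k\<close> bounds the
  ratio of diameters in \<open>T\<close>. If \<open>n = l + k\<close>, then the maximal shrinking in \<open>S\<close> gives
  \<open>1 \<le> C ^ k * (A * t)\<close>, and contraction in \<open>T\<close> bounds the ratio by \<open>r ^ k\<close>. The exponents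
  \<open>a\<close> and \<open>b\<close> express \<open>D\<close> through \<open>1 / s\<close> and \<open>1 / r\<close> through \<open>C\<close>.\<close>

lemma tile_preserving_quasisymmetric_bound:
  fixes F :: "'a::metric_space \<Rightarrow> 'b::metric_space"
  assumes tiles: "scaled_tiles S \<X> C s" and tiles': "scaled_tiles T \<Y> D r"
    and iso: "subdivision_isomorphism \<X> \<Y> \<F>"
    and FT: "F ` S \<subseteq> T"
    and F: "\<And>n X x. \<lbrakk>X \<in> \<X> n; x \<in> S\<rbrakk> \<Longrightarrow> F x \<in> \<F> n X \<longleftrightarrow> x \<in> X"
  obtains A B a b :: real where "A > 0" "B > 0" "a > 0" "b > 0"
    "\<And>t x y z. \<lbrakk>t > 0; x \<in> S; y \<in> S; z \<in> S; dist x y \<le> t * dist x z\<rbrakk>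
       \<Longrightarrow> dist (F x) (F y) \<le> B * max ((A * t) powr a) ((A * t) powr b) * dist (F x) (F z)"
proof -
  interpret X: scaled_tiles S \<X> C s by (fact tiles)
  interpret Y: scaled_tiles T \<Y> D r by (fact tiles')
  note bij = iso_bij[OF iso]
  have image: "\<F> n X \<in> \<Y> n" if "X \<in> \<X> n" for n X
    using iso_image[OF iso that] .
  have surj: "\<exists>X\<in>\<X> n. Y = \<F> n X" if "Y \<in> \<Y> n" for n Y
    using bij[of n] that unfolding bij_betw_def by blast
  have meet_iff: "Y.meet_at n (F x) (F y) \<longleftrightarrow> X.meet_at n x y" if "x \<in> S" "y \<in> S" for n x y
  proof
    assume "Y.meet_at n (F x) (F y)"
    then obtain X Y where "X \<in> \<X> n" "Y \<in> \<X> n" "F x \<in> \<F> n X" "F y \<in> \<F> n Y" "\<F> n X \<inter> \<F> n Y \<noteq> {}"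
      unfolding Y.meet_at_def using surj by metis
    then show "X.meet_at n x y"
      using iso_meet_iff[OF iso] that F unfolding X.meet_at_def by metis
  next
    assume "X.meet_at n x y"
    then obtain X Y where "X \<in> \<X> n" "Y \<in> \<X> n" "x \<in> X" "y \<in> Y" "X \<inter> Y \<noteq> {}"
      unfolding X.meet_at_def by blast
    then show "Y.meet_at n (F x) (F y)"
      using iso_meet_iff[OF iso] that F image unfolding Y.meet_at_def by metis
  qed
  obtain a where a: "a > 0" "\<And>k. D ^ k = ((1 / s) ^ k) powr a"
    using power_eq_powr_power[of "1 / s" D] X.s_pos X.s_lt_1 Y.C_gt_1 by auto
  obtain b where b: "b > 0" "\<And>k. (1 / r) ^ k = (C ^ k) powr b"
    using power_eq_powr_power[of C "1 / r"] Y.s_pos Y.s_lt_1 X.C_gt_1 by auto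
  \<comment> \<open>\<open>C ^ 3\<close>, \<open>2 * C\<^sup>2\<close> (and likewise for \<open>D\<close>) compare distances with tile diameters; the extra factor
    \<open>C\<close>, respectively \<open>D\<close>, is the constant in the geometric shrinking.\<close>
  define A where "A = C * (C ^ 3 * (2 * C\<^sup>2))"
  define B where "B = 2 * D\<^sup>2 * (D * D ^ 3)"
  have pos: "A > 0" "B > 0" using X.C_gt_1 Y.C_gt_1 by (auto simp: A_def B_def)
  have "dist (F x) (F y) \<le> B * max ((A * t) powr a) ((A * t) powr b) * dist (F x) (F z)"
    if t: "t > 0" and x: "x \<in> S" and y: "y \<in> S" and z: "z \<in> S"
      and le: "dist x y \<le> t * dist x z" for t x y z
  proof (cases "x = y")
    case True
    then show ?thesis using pos by (auto simp: le_max_iff_disj)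
  next
    case False
    then have xz: "x \<noteq> z" using le by auto
    let ?M = "max ((A * t) powr a) ((A * t) powr b)"
    obtain n where n: "X.meet_at n x y" "\<not> X.meet_at (Suc n) x y"
      using X.separation_level[OF x y False] .
    obtain l where l: "X.meet_at l x z" "\<not> X.meet_at (Suc l) x z"
      using X.separation_level[OF x z xz] .
    obtain P where P: "P \<in> \<X> n" "x \<in> P" using X.obtain_tile[OF x] .
    obtain Q where Q: "Q \<in> \<X> l" "x \<in> Q" using X.obtain_tile[OF x] .
    have P': "\<F> n P \<in> \<Y> n" "F x \<in> \<F> n P" and Q': "\<F> l Q \<in> \<Y> l" "F x \<in> \<F> l Q"
      using P Q image F x by auto
    have xz_le: "dist x z \<le> 2 * C\<^sup>2 * diameter Q" using X.dist_le_if_meet[OF l(1) Q] .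
    then have Q_pos: "diameter Q > 0"
      using xz X.C_gt_1 X.diameter_nonneg[OF Q(1)]
      by (metis dist_le_zero_iff less_eq_real_def mult_zero_right)
    have "diameter P \<le> C ^ 3 * dist x y" using X.diameter_le_if_not_meet[OF n(2) P y] .
    also have "\<dots> \<le> C ^ 3 * (t * (2 * C\<^sup>2 * diameter Q))"
      using le xz_le t X.C_gt_1 by (intro mult_left_mono) (auto intro: order_trans)
    finally have "C * diameter P \<le> C * (C ^ 3 * (t * (2 * C\<^sup>2 * diameter Q)))"
      using X.C_gt_1 by (intro mult_left_mono) auto
    then have PQ: "C * diameter P \<le> A * t * diameter Q" by (simp add: A_def mult_ac)
    have Fxy: "dist (F x) (F y) \<le> 2 * D\<^sup>2 * diameter (\<F> n P)"
      using Y.dist_le_if_meet[OF _ P'] meet_iff x y n by blast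
    have Fxz: "diameter (\<F> l Q) \<le> D ^ 3 * dist (F x) (F z)"
      using Y.diameter_le_if_not_meet[OF _ Q'] meet_iff x z l FT by blast
    have key: "diameter (\<F> n P) \<le> D * ?M * diameter (\<F> l Q)"
    proof (cases "n \<le> l")
      case True
      then obtain k where k: "l = n + k" using le_iff_add by blast
      have "diameter Q \<le> C * s ^ k * diameter P"
        using X.descendant_diameter_le[of P n Q k x] P Q k by simp
      also have "\<dots> = s ^ k * (C * diameter P)" by simp
      also have "\<dots> \<le> s ^ k * (A * t * diameter Q)"
        using PQ X.s_pos by (intro mult_left_mono) auto
      finally have "diameter Q * 1 \<le> diameter Q * (s ^ k * (A * t))" by (simp add: mult_ac)
      then have "1 \<le> s ^ k * (A * t)" using Q_pos mult_le_cancel_left_pos by blast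
      then have "(1 / s) ^ k \<le> A * t" using X.s_pos by (simp add: field_simps)
      then have "D ^ k \<le> (A * t) powr a"
        unfolding a(2) using a(1) X.s_pos by (intro powr_mono2) auto
      then have "D * D ^ k * diameter (\<F> l Q) \<le> D * ?M * diameter (\<F> l Q)"
        using Y.C_gt_1 Y.diameter_nonneg[OF Q'(1)]
        by (intro mult_right_mono mult_left_mono) auto
      then show ?thesis
        using Y.diameter_le_descendant[of "\<F> n P" n "\<F> l Q" k "F x"] P' Q' k by auto
    next
      case False
      then obtain k where k: "n = l + k" using le_iff_add nat_le_linear by blast
      have "diameter Q \<le> C * C ^ k * diameter P"
        using X.diameter_le_descendant[of Q l P k x] P Q k by simp
      also have "\<dots> = C ^ k * (C * diameter P)" by simp
      also have "\<dots> \<le> C ^ k * (A * t * diameter Q)"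
        using PQ X.C_gt_1 by (intro mult_left_mono) auto
      finally have "diameter Q * 1 \<le> diameter Q * (C ^ k * (A * t))" by (simp add: mult_ac)
      then have "1 \<le> C ^ k * (A * t)" using Q_pos mult_le_cancel_left_pos by blast
      then have "1 \<le> (C ^ k * (A * t)) powr b" using b(1) by (simp add: ge_one_powr_ge_zero)
      also have "\<dots> = (1 / r) ^ k * (A * t) powr b"
        using X.C_gt_1 pos t by (simp add: powr_mult flip: b(2))
      finally have "r ^ k \<le> (A * t) powr b" using Y.s_pos by (simp add: field_simps)
      then have "D * r ^ k * diameter (\<F> l Q) \<le> D * ?M * diameter (\<F> l Q)"
        using Y.C_gt_1 Y.diameter_nonneg[OF Q'(1)]
        by (intro mult_right_mono mult_left_mono) auto
      then show ?thesis
        using Y.descendant_diameter_le[of "\<F> l Q" l "\<F> n P" k "F x"] P' Q' k by auto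
    qed
    also have "\<dots> \<le> D * ?M * (D ^ 3 * dist (F x) (F z))"
      using Fxz Y.C_gt_1 by (intro mult_left_mono) (auto simp: le_max_iff_disj)
    finally have "2 * D\<^sup>2 * diameter (\<F> n P) \<le> 2 * D\<^sup>2 * (D * ?M * (D ^ 3 * dist (F x) (F z)))"
      by (intro mult_left_mono) auto
    also have "\<dots> = B * ?M * dist (F x) (F z)" by (simp add: B_def)
    finally show ?thesis using Fxy by linarith
  qed
  then show thesis using that pos a(1) b(1) by blast
qed

section \<open>Isomorphic quasi-visual subdivisions\<close>

theorem proposition2p13:
  fixes S :: "'a::metric_space set" and T :: "'b::metric_space set"
    and \<X> :: "nat \<Rightarrow> 'a set set" and \<Y> :: "nat \<Rightarrow> 'b set set"
    and \<F> :: "nat \<Rightarrow> 'a set \<Rightarrow> 'b set"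
  assumes "compact S" and "compact T"
    and "quasi_visual_subdivision S \<X>" and "quasi_visual_subdivision T \<Y>"
    and "subdivision_isomorphism \<X> \<Y> \<F>"
  shows "\<exists>!F. F \<in> extensional S \<and> quasisymmetric_homeomorphism S T F \<and>
           (\<forall>n. \<forall>X\<in>\<X> n. F ` X = \<F> n X)"
proof -
  note iso = \<open>subdivision_isomorphism \<X> \<Y> \<F>\<close>
  have sub: "subdivision S \<X>" and sub': "subdivision T \<Y>"
    using assms by (auto simp: quasi_visual_subdivision_def)
  obtain C s where tiles: "scaled_tiles S \<X> C s"
    using assms quasi_visual_approximation_scaled unfolding quasi_visual_subdivision_def by blast
  obtain D r where tiles': "scaled_tiles T \<Y> D r"
    using assms quasi_visual_approximation_scaled unfolding quasi_visual_subdivision_def by blast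
  interpret X: scaled_tiles S \<X> C s by (fact tiles)
  interpret Y: scaled_tiles T \<Y> D r by (fact tiles')
  define \<G> where "\<G> n = inv_into (\<X> n) (\<F> n)" for n
  have iso': "subdivision_isomorphism \<Y> \<X> \<G>"
    using subdivision_isomorphism_inverse[OF iso] unfolding \<G>_def .
  note bij = iso_bij[OF iso]
  have image: "\<F> n X \<in> \<Y> n" and inv: "\<G> n (\<F> n X) = X" if "X \<in> \<X> n" for n X
    using bij[of n] that by (auto simp: \<G>_def bij_betw_def)
  obtain F0 where F0: "\<And>x. x \<in> S \<Longrightarrow> F0 x \<in> T"
      "\<And>n X x. \<lbrakk>x \<in> S; X \<in> \<X> n; x \<in> X\<rbrakk> \<Longrightarrow> F0 x \<in> \<F> n X"
    using corresponding_point_exists[OF sub sub' tiles tiles' iso] by metis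
  define F where "F = restrict F0 S"
  have FT: "F x \<in> T" if "x \<in> S" for x using F0 that by (simp add: F_def)
  have F_iff: "F x \<in> \<F> n X \<longleftrightarrow> x \<in> X" if "X \<in> \<X> n" "x \<in> S" for n X x
    using corresponding_point_iff[OF sub sub' tiles tiles' iso that(2) FT[OF that(2)] _ that(1)]
      F0(2) that by (simp add: F_def)
  have inj: "inj_on F S"
  proof (rule inj_onI)
    fix x y assume xy: "x \<in> S" "y \<in> S" "F x = F y"
    show "x = y"
    proof (rule X.eq_if_same_tiles)
      fix n
      obtain X where "X \<in> \<X> n" "x \<in> X" using X.obtain_tile[OF xy(1)] .
      then show "\<exists>X\<in>\<X> n. x \<in> X \<and> y \<in> X" using F_iff xy by metis
    qed
  qed
  have surj: "\<exists>x\<in>S. F x = y" if y: "y \<in> T" for y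
  proof -
    obtain x where x: "x \<in> S" "\<And>n Y. \<lbrakk>Y \<in> \<Y> n; y \<in> Y\<rbrakk> \<Longrightarrow> x \<in> \<G> n Y"
      using corresponding_point_exists[OF sub' sub tiles' tiles iso' y] by blast
    have "F x = y"
    proof (rule Y.eq_if_same_tiles)
      fix n
      obtain Y where Y: "Y \<in> \<Y> n" "y \<in> Y" using Y.obtain_tile[OF y] .
      then obtain X where X: "X \<in> \<X> n" "Y = \<F> n X"
        using bij[of n] unfolding bij_betw_def by blast
      then have "x \<in> X" using x(2)[OF Y] inv by simp
      then show "\<exists>Y\<in>\<Y> n. F x \<in> Y \<and> y \<in> Y" using F_iff X Y x(1) by blast
    qed
    then show ?thesis using x by blast
  qed
  have img: "F ` X = \<F> n X" if X: "X \<in> \<X> n" for n X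
  proof
    show "F ` X \<subseteq> \<F> n X" using F_iff X X.tile_subset by blast
    show "\<F> n X \<subseteq> F ` X"
    proof
      fix y assume y: "y \<in> \<F> n X"
      then obtain x where "x \<in> S" "F x = y" using surj Y.tile_subset image[OF X] by blast
      then show "y \<in> F ` X" using F_iff X y by blast
    qed
  qed
  have FST: "F ` S = T" using FT surj by blast
  obtain A B a b :: real where pos: "A > 0" "B > 0" "a > 0" "b > 0"
    and bound: "\<And>t x y z. \<lbrakk>t > 0; x \<in> S; y \<in> S; z \<in> S; dist x y \<le> t * dist x z\<rbrakk>
       \<Longrightarrow> dist (F x) (F y) \<le> B * max ((A * t) powr a) ((A * t) powr b) * dist (F x) (F z)"
    using tile_preserving_quasisymmetric_bound[OF tiles tiles' iso _ F_iff] FST by blast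
  note gauge = homeomorphism_max_powr[OF pos]
  have "continuous_on S F"
    by (rule quasisymmetric_bound_imp_continuous[OF homeomorphism_cont1[OF gauge] _ bound]) simp_all
  then have "\<exists>G. homeomorphism S T F G"
    using homeomorphism_compact[OF \<open>compact S\<close> _ FST inj] by blast
  then have "quasisymmetric_homeomorphism S T F"
    unfolding quasisymmetric_homeomorphism_def using gauge bound by blast
  moreover have "F' = F" if ext: "F' \<in> extensional S" and F': "\<And>n X. X \<in> \<X> n \<Longrightarrow> F' ` X = \<F> n X"
    for F'
  proof (rule extensionalityI[OF ext])
    fix x assume x: "x \<in> S"
    show "F' x = F x"
    proof (rule Y.eq_if_same_tiles)
      fix n
      obtain X where "X \<in> \<X> n" "x \<in> X" using X.obtain_tile[OF x] .
      then have "F' x \<in> \<F> n X" "F x \<in> \<F> n X" "\<F> n X \<in> \<Y> n"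
        using F'[of X n] img[of X n] image[of X n] by auto
      then show "\<exists>Y\<in>\<Y> n. F' x \<in> Y \<and> F x \<in> Y" by blast
    qed
  qed (simp add: F_def)
  ultimately show ?thesis
    using img by (intro ex1I[of _ F]) (auto simp: F_def)
qed

end
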